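(* Let $T>0$, let $\mu$ be a nonnegative Radon measure on $[0,T]$ and let $h:[0,T]\times\mathbb{R}^d\to\overline{\mathbb{R}}$ be a convex normal integrand. Let $S_t:=\mathrm{cl}\,\mathrm{dom}\,h(t,\cdot)$ for $t\in[0,T]$, and assume that (i) $S_t=\mathrm{cl}\,\{y(t)\mid y\in\mathsf{D}(S)\}$ for all $t\in[0,T]$; (ii) $\mathsf{D}(S)=\mathrm{cl}(\mathrm{dom}\,K\cap\mathsf{D}(S))$ with respect to pointwise convergence, meaning that for each $y\in\mathsf{D}(S)$ there exists a sequence $(y_\nu)_{\nu=1}^\infty\subset\mathrm{dom}\,K\cap\mathsf{D}(S)$ converging pointwise to $y$. Then $$\inf_{y\in\mathsf{D}(S)}\int_{[0,T]}h(t,y(t))\,\mu(dt)=\int_{[0,T]}\inf_{y\in\mathbb{R}^d}h(t,y)\,\mu(dt)$$ as soon as the left side is less than $+\infty$.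
   Context: $\overline{\mathbb{R}}$ denotes the extended real line. A function $h:[0,T]\times\mathbb{R}^d\to\overline{\mathbb{R}}$ is a normal integrand on $[0,T]$ if the set-valued mapping $t\mapsto\mathrm{epi}\,h(t):=\{(x,\alpha)\in\mathbb{R}^d\times\mathbb{R}\mid h(t,x)\le\alpha\}$ is closed-valued and measurable (i.e. $\{t\mid \mathrm{epi}\,h(t)\cap O\neq\emptyset\}$ is measurable for every open $O\subset\mathbb{R}^d\times\mathbb{R}$); it is a convex normal integrand if this mapping is also convex-valued. $\mathrm{dom}\,h(t,\cdot)=\{y\in\mathbb{R}^d\mid h(t,y)<\infty\}$. A function $y:[0,T]\to\mathbb{R}^d$ is cadlag if it is right-continuous and has left limits; $\mathsf{D}(S)$ is the set of cadlag functions $y$ with $y(t)\in S_t$ for all $t\in[0,T]$. The integral functional is $K(y):=\int_{[0,T]}h(t,y(t))\,\mu(dt)$ for measurable $y:[0,T]\to\mathbb{R}^d$, and $\mathrm{dom}\,K=\{y\mid K(y)<+\infty\}$. An integral is defined as $+\infty$ unless the positive part of the integrand is integrable. *)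

theory Defs
  imports "HOL-Analysis.Analysis"
begin

text \<open>
  The \<open>\<sigma>\<close>-algebra is only required to contain the Borel sets of \<open>X\<close>, so that both the Borel
  measure itself and its completion are admitted; inner regularity excludes anything finer
  than the completion.
\<close>

definition radon_measure_on :: "'a::t2_space set \<Rightarrow> 'a measure \<Rightarrow> bool" where
  "radon_measure_on X M \<longleftrightarrow>
     space M = X \<and>
     sets (restrict_space borel X) \<subseteq> sets M \<and>
     (\<forall>C. compact C \<and> C \<subseteq> X \<longrightarrow> emeasure M C < \<infinity>) \<and>
     (\<forall>A\<in>sets M. emeasure M A = (SUP C\<in>{C. compact C \<and> C \<subseteq> A}. emeasure M C))"

definition epi :: "('a \<Rightarrow> ereal) \<Rightarrow> ('a \<times> real) set" where
  "epi f = {(x, \<alpha>). f x \<le> ereal \<alpha>}"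

definition effective_domain :: "('a \<Rightarrow> ereal) \<Rightarrow> 'a set" where
  "effective_domain f = {x. f x < \<infinity>}"

definition measurable_set_valued :: "'t measure \<Rightarrow> ('t \<Rightarrow> 'b::topological_space set) \<Rightarrow> bool" where
  "measurable_set_valued M F \<longleftrightarrow> (\<forall>U. open U \<longrightarrow> {t \<in> space M. F t \<inter> U \<noteq> {}} \<in> sets M)"

definition normal_integrand ::
  "'t measure \<Rightarrow> ('t \<Rightarrow> 'a::topological_space \<Rightarrow> ereal) \<Rightarrow> bool" where
  "normal_integrand M h \<longleftrightarrow>
     (\<forall>t\<in>space M. closed (epi (h t))) \<and> measurable_set_valued M (\<lambda>t. epi (h t))"

definition convex_normal_integrand ::
  "'t measure \<Rightarrow> ('t \<Rightarrow> 'a::real_normed_vector \<Rightarrow> ereal) \<Rightarrow> bool" where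
  "convex_normal_integrand M h \<longleftrightarrow>
     normal_integrand M h \<and> (\<forall>t\<in>space M. convex (epi (h t)))"

text \<open>
  Only values on \<open>[0,T]\<close> matter. At \<open>t = T\<close> the first condition and at \<open>t = 0\<close> the second one
  hold trivially, the filter being trivial there.
\<close>

definition cadlag_on :: "real \<Rightarrow> (real \<Rightarrow> 'a::topological_space) \<Rightarrow> bool" where
  "cadlag_on T y \<longleftrightarrow>
     (\<forall>t\<in>{0..T}. (y \<longlongrightarrow> y t) (at t within {t<..T}) \<and>
                 (\<exists>l. (y \<longlongrightarrow> l) (at t within {0..<t})))"

definition cadlag_selections ::
  "real \<Rightarrow> (real \<Rightarrow> 'a::topological_space set) \<Rightarrow> (real \<Rightarrow> 'a) set" where
  "cadlag_selections T S = {y. cadlag_on T y \<and> (\<forall>t\<in>{0..T}. y t \<in> S t)}"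

text \<open>
  Here \<open>e2ennreal\<close> sends negative values to \<open>0\<close>, so the two nonnegative integrals are those of the
  positive and negative parts. The negative part may have infinite integral, giving \<open>-\<infinity>\<close>.
\<close>

definition ereal_integral :: "'t measure \<Rightarrow> ('t \<Rightarrow> ereal) \<Rightarrow> ereal" where
  "ereal_integral M f =
     (if f \<in> borel_measurable M \<and> (\<integral>\<^sup>+t. e2ennreal (f t) \<partial>M) < \<infinity>
      then enn2ereal (\<integral>\<^sup>+t. e2ennreal (f t) \<partial>M) - enn2ereal (\<integral>\<^sup>+t. e2ennreal (- f t) \<partial>M)
      else \<infinity>)"

definition integral_functional ::
  "'t measure \<Rightarrow> ('t \<Rightarrow> 'a \<Rightarrow> ereal) \<Rightarrow> ('t \<Rightarrow> 'a) \<Rightarrow> ereal" where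
  "integral_functional M h y = ereal_integral M (\<lambda>t. h t (y t))"

definition dom_integral_functional ::
  "'t measure \<Rightarrow> ('t \<Rightarrow> 'a::topological_space \<Rightarrow> ereal) \<Rightarrow> ('t \<Rightarrow> 'a) set" where
  "dom_integral_functional M h = {y \<in> borel_measurable M. integral_functional M h y < \<infinity>}"

end

theory Submission
  imports Defs
begin

text \<open>
  That the integral of the pointwise infimum is a lower bound is monotonicity. For the other
  inequality, the selections are restricted to a countable family and the pointwise infimum is
  reached by switching inside it.

  What is known of the integrand along one selection holds only outside a null set that depends on
  the selection, so a countable family of selections is needed whose values are dense in \<open>S t\<close>.
  Right-continuity provides such a family: the sets of times at which a cadlag function visits a given open set
  are open in the Sorgenfrey topology, which is hereditarily Lindelof
  (\<open>cadlag_family_countable_dense\<close>). By the second approximation hypothesis the family can be taken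
  in the domain of the integral functional. Almost everywhere all its values then lie in the
  effective domain of \<open>h t\<close> and are dense there, and for a convex function on a Euclidean space the
  infimum over a dense subset of its domain is the full infimum
  (\<open>INF_dense_subset_of_effective_domain\<close>). Hence the pointwise infimum of the integrand is almost
  everywhere a countable infimum of \<open>h t (Y n t)\<close> with \<open>Y n\<close> in the domain of the functional.

  Such a countable infimum is the limit of finite minima. A finite minimum is attained by switching
  among \<open>Y 0, \<dots>, Y n\<close> on measurable sets. The result of such a switch is in general not cadlag, but inner
  regularity lets one replace the measurable sets by unions of half-open grid cells
  (\<open>measurable_set_grid_approximation\<close>), on which switching preserves cadlag functions, at the cost
  of an exceptional set. Since the switched function takes only values of finitely many functions in
  the domain of the functional, the positive part of its integrand is dominated by one integrable
  weight, and the exceptional set can be chosen small for that weight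
  (\<open>INF_integral_functional_le_integral_finite_minimum\<close>). Monotone and dominated convergence finish
  the proof.
\<close>

section \<open>Infima of convex functions over dense subsets of the domain\<close>

text \<open>A short step from a point of a strict sublevel set towards any point of the effective domain
  stays in the sublevel set. The values of \<open>f\<close> may be \<open>-\<infinity>\<close>, so the estimate is made with real
  heights in the epigraph.\<close>
lemma convex_epi_combination_less:
  fixes f :: "'a::real_normed_vector \<Rightarrow> ereal"
  assumes cvx: "convex (epi f)" and x: "f x < ereal a" and z: "f z < \<infinity>"
  obtains t :: real where "0 < t" "f ((1 - t) *\<^sub>R x + t *\<^sub>R z) < ereal a"
proof -
  obtain c where c: "f x < ereal c" "ereal c < ereal a"
    using ereal_dense2[OF x] by blast
  obtain b where b: "f z < ereal b"
    using ereal_dense2[OF z] by blast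
  define t where "t = min 1 ((a - c) / (\<bar>b - c\<bar> + 1))"
  have t: "0 < t" "t \<le> 1"
    using c by (auto simp: t_def)
  have "t * (b - c) \<le> t * \<bar>b - c\<bar>"
    using t by (intro mult_left_mono) auto
  also have "\<dots> < t * (\<bar>b - c\<bar> + 1)"
    using t by simp
  also have "\<dots> \<le> (a - c) / (\<bar>b - c\<bar> + 1) * (\<bar>b - c\<bar> + 1)"
    by (intro mult_right_mono) (auto simp: t_def)
  also have "\<dots> = a - c"
    by (simp add: nonzero_eq_divide_eq)
  finally have less: "(1 - t) * c + t * b < a"
    by (simp add: algebra_simps)
  have "(1 - t) *\<^sub>R (x, c) + t *\<^sub>R (z, b) \<in> epi f"
    using cvx b c t by (intro convexD_alt) (auto simp: epi_def)
  then have "f ((1 - t) *\<^sub>R x + t *\<^sub>R z) \<le> ereal ((1 - t) * c + t * b)"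
    by (simp add: epi_def)
  also have "\<dots> < ereal a"
    using less by simp
  finally show ?thesis
    using that t by blast
qed

text \<open>A nonempty strict sublevel set \<open>C\<close> has the same affine hull as the effective domain, because
  from a point of \<open>C\<close> one can move a little towards every point of the domain without leaving \<open>C\<close>.
  So a relative interior point of \<open>C\<close> has a neighbourhood in the domain that lies in \<open>C\<close>, and a
  dense subset of the domain meets it.\<close>
lemma INF_dense_subset_of_effective_domain:
  fixes f :: "'a::euclidean_space \<Rightarrow> ereal"
  assumes cvx: "convex (epi f)"
    and D: "D \<subseteq> effective_domain f" "effective_domain f \<subseteq> closure D"
  shows "(INF x\<in>D. f x) = (INF x. f x)"
proof (rule antisym)
  show "(INF x. f x) \<le> (INF x\<in>D. f x)"
    by (rule INF_superset_mono) auto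
  show "(INF x\<in>D. f x) \<le> (INF x. f x)"
  proof (rule INF_greatest, rule ccontr)
    fix x assume "\<not> (INF x\<in>D. f x) \<le> f x"
    then have "f x < (INF x\<in>D. f x)"
      by simp
    then obtain a where a: "f x < ereal a" "ereal a < (INF x\<in>D. f x)"
      using ereal_dense2 by blast
    define C where "C = {z. f z < ereal a}"
    have "x \<in> C"
      using a by (simp add: C_def)
    have hull: "effective_domain f \<subseteq> affine hull C"
    proof
      fix z assume "z \<in> effective_domain f"
      then have "f z < \<infinity>"
        by (simp add: effective_domain_def)
      from convex_epi_combination_less[OF cvx a(1) this]
      obtain t where t: "0 < t" "(1 - t) *\<^sub>R x + t *\<^sub>R z \<in> C"
        by (auto simp: C_def)
      have "(1 - 1/t) *\<^sub>R x + (1/t) *\<^sub>R ((1 - t) *\<^sub>R x + t *\<^sub>R z) \<in> affine hull C"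
        by (rule mem_affine[OF affine_affine_hull hull_inc[OF \<open>x \<in> C\<close>] hull_inc[OF t(2)]]) simp
      also have "(1 - 1/t) *\<^sub>R x + (1/t) *\<^sub>R ((1 - t) *\<^sub>R x + t *\<^sub>R z) = z"
        using t by (simp add: algebra_simps)
      finally show "z \<in> affine hull C" .
    qed
    have "convex C"
    proof (rule convexI)
      fix u v :: 'a and p q :: real
      assume uv: "u \<in> C" "v \<in> C" and pq: "0 \<le> p" "0 \<le> q" "p + q = 1"
      obtain b where b: "f u < ereal b" "ereal b < ereal a"
        using uv ereal_dense2[of "f u" "ereal a"] by (auto simp: C_def)
      obtain c where c: "f v < ereal c" "ereal c < ereal a"
        using uv ereal_dense2[of "f v" "ereal a"] by (auto simp: C_def)
      have "p *\<^sub>R (u, b) + q *\<^sub>R (v, c) \<in> epi f"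
        using cvx b c pq by (intro convexD) (auto simp: epi_def)
      then have "f (p *\<^sub>R u + q *\<^sub>R v) \<le> ereal (p * b + q * c)"
        by (simp add: epi_def)
      also have "p * b + q * c < a"
        using convex_bound_lt[of b a c p q] b c pq by auto
      finally show "p *\<^sub>R u + q *\<^sub>R v \<in> C"
        by (simp add: C_def)
    qed
    then have "rel_interior C \<noteq> {}"
      using \<open>x \<in> C\<close> rel_interior_eq_empty by blast
    then obtain p e where p: "p \<in> C" "0 < e" "ball p e \<inter> affine hull C \<subseteq> C"
      by (auto simp: mem_rel_interior_ball)
    have "f p < \<infinity>"
      using p(1) less_trans[of "f p" "ereal a" \<infinity>] by (simp add: C_def)
    then have "p \<in> closure D"
      using D by (auto simp: effective_domain_def)
    then obtain d where "d \<in> D" "dist d p < e"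
      using p(2) closure_approachable by blast
    then have "d \<in> ball p e \<inter> affine hull C"
      using subsetD[OF hull subsetD[OF D(1)]] by (simp add: dist_commute)
    then have "d \<in> C"
      using p(3) by (rule subsetD[rotated])
    then show False
      using a(2) \<open>d \<in> D\<close> INF_lower[of d D f] by (force simp: C_def)
  qed
qed

section \<open>Countable dense families of cadlag functions\<close>

text \<open>This is the hereditary Lindelof property of the Sorgenfrey line. The usual interiors
  of the \<open>A i\<close> have a countable subcover by second countability; a point \<open>t\<close> that they miss has an
  interval \<open>{t<..<q}\<close> covered by them, so the missed points can be told apart by rational numbers
  \<open>q\<close> and are countably many.\<close>
lemma right_open_cover_countable_subcover:
  fixes A :: "'i \<Rightarrow> real set"
  assumes right_open: "\<And>i t. i \<in> I \<Longrightarrow> t \<in> A i \<Longrightarrow> \<exists>r>0. {t..<t + r} \<subseteq> A i"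
  obtains J where "J \<subseteq> I" "countable J" "(\<Union>i\<in>J. A i) = (\<Union>i\<in>I. A i)"
proof -
  define V where "V = (\<Union>i\<in>I. interior (A i))"
  obtain \<F> where \<F>: "\<F> \<subseteq> (\<lambda>i. interior (A i)) ` I" "countable \<F>" "\<Union>\<F> = V"
    by (rule Lindelof[of "(\<lambda>i. interior (A i)) ` I"]) (auto simp: V_def)
  obtain J1 where J1: "J1 \<subseteq> I" "countable J1" "\<F> = (\<lambda>i. interior (A i)) ` J1"
    using \<F>(1,2) countable_subset_image by metis
  define R where "R = (\<Union>i\<in>I. A i) - V"
  \<comment> \<open>The missed points are countable: the chosen rational \<open>q\<close> separates \<open>t\<close> from every later one,
    which cannot lie in \<open>{t<..<q}\<close>.\<close>
  have "\<exists>q\<in>\<rat>. t < q \<and> {t<..<q} \<subseteq> V" if t: "t \<in> R" for t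
  proof -
    obtain i where i: "i \<in> I" "t \<in> A i"
      using t by (auto simp: R_def)
    then obtain r where r: "r > 0" "{t..<t + r} \<subseteq> A i"
      using right_open by blast
    obtain q where q: "q \<in> \<rat>" "t < q" "q < t + r"
      using Rats_dense_in_real[of t "t + r"] r by auto
    have "{t<..<q} \<subseteq> interior (A i)"
      using r q by (intro interior_maximal) auto
    then show ?thesis
      using q i by (auto simp: V_def)
  qed
  then obtain q where q: "\<And>t. t \<in> R \<Longrightarrow> q t \<in> \<rat> \<and> t < q t \<and> {t<..<q t} \<subseteq> V"
    by metis
  have "inj_on q R"
  proof (rule linorder_inj_onI)
    fix s t assume "s < t" "s \<in> R" "t \<in> R"
    then show "q s \<noteq> q t"
      using q[of s] q[of t] by (auto simp: R_def subset_eq)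
  qed auto
  moreover have "countable (q ` R)"
    using q by (intro countable_subset[OF _ countable_rat]) auto
  ultimately have "countable R"
    using countable_image_inj_on by blast
  have "\<forall>t\<in>R. \<exists>i\<in>I. t \<in> A i"
    by (auto simp: R_def)
  then obtain k where k: "\<And>t. t \<in> R \<Longrightarrow> k t \<in> I \<and> t \<in> A (k t)"
    by metis
  show ?thesis
  proof
    show "J1 \<union> k ` R \<subseteq> I" "countable (J1 \<union> k ` R)"
      using J1 k \<open>countable R\<close> by auto
    have "V \<subseteq> (\<Union>i\<in>J1. A i)"
      using \<F>(3) J1(3) interior_subset by fastforce
    moreover have "R \<subseteq> (\<Union>i\<in>k ` R. A i)"
      using k by auto
    ultimately have "(\<Union>i\<in>I. A i) \<subseteq> (\<Union>i\<in>J1 \<union> k ` R. A i)"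
      unfolding R_def by blast
    then show "(\<Union>i\<in>J1 \<union> k ` R. A i) = (\<Union>i\<in>I. A i)"
      using J1(1) k by blast
  qed
qed

text \<open>Right-continuity makes \<open>{t. y t \<in> B}\<close> right-open for open \<open>B\<close>, so for each basic open set
  countably many members of \<open>F\<close> hit it at all the times at which some member does. The family \<open>J\<close>
  is dense at every time, not merely at almost every time.\<close>
lemma cadlag_family_countable_dense:
  fixes F :: "(real \<Rightarrow> 'a::second_countable_topology) set"
  assumes cadlag: "\<And>y. y \<in> F \<Longrightarrow> cadlag_on T y"
  obtains J where "J \<subseteq> F" "countable J"
    "\<And>t y. t \<in> {0..T} \<Longrightarrow> y \<in> F \<Longrightarrow> y t \<in> closure {z t | z. z \<in> J}"
proof -
  obtain \<B> :: "'a set set" where \<B>: "countable \<B>" "topological_basis \<B>"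
    using ex_countable_basis by blast
  \<comment> \<open>Extending \<open>y\<close> by \<open>y T\<close> beyond \<open>T\<close> makes the sets right-open at \<open>T\<close> as well.\<close>
  define A where "A = (\<lambda>(B :: 'a set) (y :: real \<Rightarrow> 'a). {t. 0 \<le> t \<and> y (min t T) \<in> B})"
  have "\<exists>J\<subseteq>F. countable J \<and> (\<Union>y\<in>J. A B y) = (\<Union>y\<in>F. A B y)" if "B \<in> \<B>" for B
  proof -
    have "open B"
      using \<B>(2) that topological_basis_open by blast
    have "\<exists>r>0. {t..<t + r} \<subseteq> A B y" if y: "y \<in> F" and t: "t \<in> A B y" for y t
    proof (cases "t < T")
      case True
      have "(y \<longlongrightarrow> y t) (at t within {t<..T})"
        using cadlag[OF y] t True by (auto simp: A_def cadlag_on_def)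
      then have "eventually (\<lambda>s. y s \<in> B) (at t within {t<..T})"
        using \<open>open B\<close> t True by (auto simp: A_def dest: topological_tendstoD)
      then obtain d where d: "d > 0" "\<And>s. s \<in> {t<..T} \<Longrightarrow> dist s t < d \<Longrightarrow> y s \<in> B"
        unfolding eventually_at by force
      have "{t..<t + min d (T - t)} \<subseteq> A B y"
      proof
        fix s assume s: "s \<in> {t..<t + min d (T - t)}"
        then show "s \<in> A B y"
          using t d(2)[of s] True by (cases "s = t") (auto simp: A_def dist_real_def)
      qed
      then show ?thesis
        using d True by (intro exI[of _ "min d (T - t)"]) auto
    next
      case False
      then have "{t..<t + 1} \<subseteq> A B y"
        using t by (auto simp: A_def)
      then show ?thesis
        by (intro exI[of _ 1]) auto
    qed
    then obtain J where "J \<subseteq> F" "countable J" "(\<Union>y\<in>J. A B y) = (\<Union>y\<in>F. A B y)"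
      by (rule right_open_cover_countable_subcover[of F "A B"])
    then show ?thesis
      by blast
  qed
  then obtain J where J: "\<And>B. B \<in> \<B> \<Longrightarrow>
      J B \<subseteq> F \<and> countable (J B) \<and> (\<Union>y\<in>J B. A B y) = (\<Union>y\<in>F. A B y)"
    by metis
  show ?thesis
  proof
    show "(\<Union>B\<in>\<B>. J B) \<subseteq> F"
      by (intro UN_least conjunct1[OF J])
    show "countable (\<Union>B\<in>\<B>. J B)"
      by (intro countable_UN \<B>(1) conjunct1[OF conjunct2[OF J]])
    fix t y assume t: "t \<in> {0..T}" and y: "y \<in> F"
    show "y t \<in> closure {z t | z. z \<in> (\<Union>B\<in>\<B>. J B)}"
    proof (rule ccontr)
      define U where "U = - closure {z t | z. z \<in> (\<Union>B\<in>\<B>. J B)}"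
      assume "y t \<notin> closure {z t | z. z \<in> (\<Union>B\<in>\<B>. J B)}"
      then have "y t \<in> U" "open U"
        by (auto simp: U_def)
      then obtain B where B: "B \<in> \<B>" "y t \<in> B" "B \<subseteq> U"
        using topological_basisE[OF \<B>(2)] by metis
      have "t \<in> (\<Union>y\<in>F. A B y)"
        using B(2) t y by (auto simp: A_def)
      also have "\<dots> = (\<Union>y\<in>J B. A B y)"
        using J[OF B(1)] by blast
      finally obtain z where z: "z \<in> J B" "z t \<in> B"
        using t by (auto simp: A_def)
      then have "z t \<in> closure {z t | z. z \<in> (\<Union>B\<in>\<B>. J B)}"
        using B(1) by (intro subsetD[OF closure_subset]) blast
      then show False
        using B(3) z(2) by (auto simp: U_def)
    qed
  qed
qed

section \<open>Switching between cadlag functions on a grid\<close>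

text \<open>On a grid cell \<open>{k * \<eta>..<(k + 1) * \<eta>}\<close> the switched function is one of the two given ones,
  and every point has an interval on its right, starting at the point, and an interval on its left
  that each lie in one cell.\<close>
lemma cadlag_on_grid_switch:
  fixes y z :: "real \<Rightarrow> 'a::topological_space"
  assumes y: "cadlag_on T y" and z: "cadlag_on T z" and "\<eta> > 0"
  shows "cadlag_on T (\<lambda>t. if \<lfloor>t / \<eta>\<rfloor> \<in> P then y t else z t)"
  unfolding cadlag_on_def
proof (intro ballI conjI)
  let ?x = "\<lambda>t. if \<lfloor>t / \<eta>\<rfloor> \<in> P then y t else z t"
  fix t assume t: "t \<in> {0..T}"
  have right: "eventually (\<lambda>s. \<lfloor>s / \<eta>\<rfloor> = \<lfloor>t / \<eta>\<rfloor>) (at t within {t<..T})"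
  proof -
    have "t < (\<lfloor>t / \<eta>\<rfloor> + 1) * \<eta>"
      using \<open>\<eta> > 0\<close> floor_correct[of "t / \<eta>"] by (simp add: field_simps)
    then have "eventually (\<lambda>s. s < (\<lfloor>t / \<eta>\<rfloor> + 1) * \<eta>) (at t within {t<..T})"
      by (intro order_tendstoD(2)[OF tendsto_ident_at])
    moreover have "eventually (\<lambda>s. s \<in> {t<..T}) (at t within {t<..T})"
      by (simp add: eventually_at_filter)
    ultimately show ?thesis
    proof eventually_elim
      case (elim s)
      have "t / \<eta> \<le> s / \<eta>" "s / \<eta> < of_int \<lfloor>t / \<eta>\<rfloor> + 1"
        using elim \<open>\<eta> > 0\<close> by (auto simp: field_simps)
      then show ?case
        using floor_correct[of "t / \<eta>"] by (intro floor_unique) linarith+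
    qed
  qed
  show "(?x \<longlongrightarrow> ?x t) (at t within {t<..T})"
  proof (cases "\<lfloor>t / \<eta>\<rfloor> \<in> P")
    case True
    have "((\<lambda>s. y s) \<longlongrightarrow> y t) (at t within {t<..T})"
      using y t by (auto simp: cadlag_on_def)
    moreover have "eventually (\<lambda>s. y s = ?x s) (at t within {t<..T})"
      using right True by (auto elim: eventually_mono)
    ultimately show ?thesis
      using True by (auto intro: Lim_transform_eventually)
  next
    case False
    have "((\<lambda>s. z s) \<longlongrightarrow> z t) (at t within {t<..T})"
      using z t by (auto simp: cadlag_on_def)
    moreover have "eventually (\<lambda>s. z s = ?x s) (at t within {t<..T})"
      using right False by (auto elim: eventually_mono)
    ultimately show ?thesis
      using False by (auto intro: Lim_transform_eventually)
  qed
  \<comment> \<open>The cell just to the left of \<open>t\<close> differs from that of \<open>t\<close> when \<open>t\<close> is a grid point.\<close>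
  define k where "k = \<lceil>t / \<eta>\<rceil> - 1"
  have left: "eventually (\<lambda>s. \<lfloor>s / \<eta>\<rfloor> = k) (at t within {0..<t})"
  proof -
    have "k * \<eta> < t"
      using \<open>\<eta> > 0\<close> ceiling_correct[of "t / \<eta>"] by (simp add: k_def field_simps)
    then have "eventually (\<lambda>s. k * \<eta> < s) (at t within {0..<t})"
      by (intro order_tendstoD(1)[OF tendsto_ident_at])
    moreover have "eventually (\<lambda>s. s \<in> {0..<t}) (at t within {0..<t})"
      by (simp add: eventually_at_filter)
    ultimately show ?thesis
    proof eventually_elim
      case (elim s)
      have "s / \<eta> < t / \<eta>" "k < s / \<eta>"
        using elim \<open>\<eta> > 0\<close> divide_strict_right_mono[of s t \<eta>]
        by (simp_all add: pos_less_divide_eq)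
      then show ?case
        using le_of_int_ceiling[of "t / \<eta>"] by (intro floor_unique) (simp_all add: k_def, linarith)
    qed
  qed
  obtain l l' where l: "(y \<longlongrightarrow> l) (at t within {0..<t})" "(z \<longlongrightarrow> l') (at t within {0..<t})"
    using y z t unfolding cadlag_on_def by blast
  show "\<exists>l. (?x \<longlongrightarrow> l) (at t within {0..<t})"
  proof (cases "k \<in> P")
    case True
    then have "eventually (\<lambda>s. y s = ?x s) (at t within {0..<t})"
      using left by (auto elim: eventually_mono)
    then show ?thesis
      using l by (auto intro: Lim_transform_eventually)
  next
    case False
    then have "eventually (\<lambda>s. z s = ?x s) (at t within {0..<t})"
      using left by (auto elim: eventually_mono)
    then show ?thesis
      using l by (auto intro: Lim_transform_eventually)
  qed
qed

text \<open>Inner regularity of \<open>\<mu>\<close> passes to a finite measure with a density. Weighting \<open>\<mu>\<close> by an integrable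
  \<open>w\<close> turns "small measure" into "small integral of everything that \<open>w\<close> dominates".\<close>
lemma radon_density_inner_regular:
  fixes \<mu> :: "real measure"
  assumes radon: "radon_measure_on {0..T} \<mu>"
    and w[measurable]: "w \<in> borel_measurable \<mu>" and fin: "(\<integral>\<^sup>+t. w t \<partial>\<mu>) < \<infinity>"
    and A: "A \<in> sets \<mu>" and "0 < (\<epsilon> :: real)"
  shows "\<exists>C\<in>sets \<mu>. compact C \<and> C \<subseteq> A \<and> emeasure (density \<mu> w) (A - C) < ennreal \<epsilon>"
proof -
  note [measurable] = A
  have sp: "space \<mu> = {0..T}"
    using radon by (simp add: radon_measure_on_def)
  have "emeasure \<mu> A \<le> emeasure \<mu> {0..T}"
    using sets.sets_into_space[OF A] by (intro emeasure_mono) (simp_all flip: sp)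
  also have "\<dots> < \<infinity>"
    using radon by (auto simp: radon_measure_on_def)
  finally have A_fin: "emeasure \<mu> A < \<infinity>" .
  have compact_sets: "C \<in> sets \<mu>" if "compact C" "C \<subseteq> A" for C
  proof -
    have "C \<in> sets (restrict_space borel {0..T})"
      using that sets.sets_into_space[OF A] sp
      by (auto simp: sets_restrict_space intro!: image_eqI[of _ _ C] borel_compact)
    then show ?thesis
      using radon by (auto simp: radon_measure_on_def)
  qed
  have "\<exists>C. compact C \<and> C \<subseteq> A \<and> emeasure \<mu> (A - C) < ennreal (1 / Suc n)" for n
  proof (cases "emeasure \<mu> A = 0")
    case True
    then show ?thesis by (intro exI[of _ "{}"]) auto
  next
    case False
    have "emeasure \<mu> A - ennreal (1 / Suc n) < emeasure \<mu> A"
      using False A_fin by (intro ennreal_between) (auto simp: zero_less_iff_neq_zero)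
    also have "emeasure \<mu> A = (SUP C\<in>{C. compact C \<and> C \<subseteq> A}. emeasure \<mu> C)"
      using radon A by (simp add: radon_measure_on_def)
    finally obtain C where C: "compact C" "C \<subseteq> A" "emeasure \<mu> A - ennreal (1 / Suc n) < emeasure \<mu> C"
      by (auto simp: less_SUP_iff)
    have "emeasure \<mu> (A - C) = emeasure \<mu> A - emeasure \<mu> C"
      using C compact_sets[of C] A emeasure_mono[of C A \<mu>] A_fin
      by (intro emeasure_Diff) auto
    also have "\<dots> < ennreal (1 / Suc n)"
    proof -
      obtain r where r: "emeasure \<mu> A = ennreal r" "0 \<le> r"
        using A_fin by (cases "emeasure \<mu> A") auto
      obtain s where s: "emeasure \<mu> C = ennreal s" "0 \<le> s"
        using emeasure_mono[OF C(2) A] A_fin by (cases "emeasure \<mu> C") (auto simp: top_unique)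
      have "ennreal (r - 1 / Suc n) < ennreal s"
        using C(3) r s by (simp add: ennreal_minus)
      then have "r - 1 / Suc n < s"
        by (rule contrapos_pp) (auto simp: not_less intro: ennreal_leI)
      then have "ennreal (r - s) < ennreal (1 / Suc n)"
        by (intro ennreal_lessI) simp_all
      then show ?thesis
        using r s by (simp add: ennreal_minus)
    qed
    finally show ?thesis
      using C by blast
  qed
  then obtain C where C: "\<And>n. compact (C n)" "\<And>n. C n \<subseteq> A"
      "\<And>n. emeasure \<mu> (A - C n) < ennreal (1 / Suc n)"
    by metis
  have [measurable]: "C n \<in> sets \<mu>" for n
    using C compact_sets by blast
  let ?\<nu> = "density \<mu> w"
  \<comment> \<open>Taking unions makes the remainders decrease; their intersection is null for \<open>\<mu>\<close>, hence for the
    density.\<close>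
  define D where "D n = A - (\<Union>k\<le>n. C k)" for n
  have D[measurable]: "D n \<in> sets \<mu>" for n
    unfolding D_def by measurable
  have "emeasure \<mu> (\<Inter>n. D n) \<le> ennreal (1 / Suc n)" for n
  proof -
    have "emeasure \<mu> (\<Inter>n. D n) \<le> emeasure \<mu> (A - C n)"
      by (intro emeasure_mono) (auto simp: D_def)
    then show ?thesis
      using C(3)[of n] by simp
  qed
  moreover have "(\<lambda>n. ennreal (1 / Suc n)) \<longlonglongrightarrow> ennreal 0"
    by (intro tendsto_ennrealI LIMSEQ_Suc[OF lim_1_over_n])
  ultimately have "emeasure \<mu> (\<Inter>n. D n) \<le> ennreal 0"
    by (intro LIMSEQ_le_const) auto
  then have "(\<Inter>n. D n) \<in> null_sets \<mu>"
    by (intro null_setsI) auto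
  then have "(\<Inter>n. D n) \<in> null_sets ?\<nu>"
    using absolutely_continuousI_density[OF w] by (auto simp: absolutely_continuous_def)
  then have null: "emeasure ?\<nu> (\<Inter>n. D n) = 0"
    by auto
  have "emeasure ?\<nu> (D n) \<noteq> \<infinity>" for n
  proof -
    have "emeasure ?\<nu> (D n) \<le> (\<integral>\<^sup>+t. w t \<partial>\<mu>)"
      by (subst emeasure_density) (auto intro!: nn_integral_mono simp: indicator_def)
    then show ?thesis
      using fin by (auto simp: top_unique)
  qed
  then have "(\<lambda>n. emeasure ?\<nu> (D n)) \<longlonglongrightarrow> emeasure ?\<nu> (\<Inter>n. D n)"
    by (intro Lim_emeasure_decseq) (auto simp: decseq_def D_def)
  then have "eventually (\<lambda>n. emeasure ?\<nu> (D n) < ennreal \<epsilon>) sequentially"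
    using \<open>0 < \<epsilon>\<close> null by (intro order_tendstoD(2)) auto
  then obtain n where "emeasure ?\<nu> (D n) < ennreal \<epsilon>"
    using eventually_happens by fastforce
  then show ?thesis
    using C by (intro bexI[of _ "\<Union>k\<le>n. C k"]) (auto simp: D_def intro!: compact_UN)
qed

text \<open>Up to a small set, \<open>A\<close> and its complement are disjoint compact sets \<open>C\<close> and \<open>C'\<close>. A grid no
  coarser than their distance has no cell that meets both, so the cells meeting \<open>C\<close> serve.\<close>
lemma measurable_set_grid_approximation:
  fixes \<nu> :: "real measure"
  assumes inner: "\<And>A \<epsilon>. A \<in> sets \<nu> \<Longrightarrow> 0 < (\<epsilon> :: real) \<Longrightarrow>
      \<exists>C\<in>sets \<nu>. compact C \<and> C \<subseteq> A \<and> emeasure \<nu> (A - C) < ennreal \<epsilon>"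
    and A: "A \<in> sets \<nu>" and "0 < (\<epsilon> :: real)"
  obtains \<eta> P E where "\<eta> > 0" "E \<in> sets \<nu>" "emeasure \<nu> E < ennreal \<epsilon>"
    "\<And>t. t \<in> space \<nu> - E \<Longrightarrow> \<lfloor>t / \<eta>\<rfloor> \<in> P \<longleftrightarrow> t \<in> A"
proof -
  obtain C where C: "C \<in> sets \<nu>" "compact C" "C \<subseteq> A" "emeasure \<nu> (A - C) < ennreal (\<epsilon> / 2)"
    using inner[OF A, of "\<epsilon> / 2"] \<open>0 < \<epsilon>\<close> by auto
  obtain C' where C': "C' \<in> sets \<nu>" "compact C'" "C' \<subseteq> space \<nu> - A"
      "emeasure \<nu> (space \<nu> - A - C') < ennreal (\<epsilon> / 2)"
    using inner[of "space \<nu> - A" "\<epsilon> / 2"] A \<open>0 < \<epsilon>\<close> by auto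
  have "C \<inter> C' = {}"
    using C C' by auto
  then obtain \<eta> where \<eta>: "\<eta> > 0" "\<And>x y. x \<in> C \<Longrightarrow> y \<in> C' \<Longrightarrow> \<eta> \<le> dist x y"
    using separate_compact_closed[OF C(2) compact_imp_closed[OF C'(2)]] by blast
  define P where "P = (\<lambda>c. \<lfloor>c / \<eta>\<rfloor>) ` C"
  define E where "E = (A - C) \<union> (space \<nu> - A - C')"
  show ?thesis
  proof
    show "\<eta> > 0" "E \<in> sets \<nu>"
      using \<eta> A C C' by (auto simp: E_def)
    have "emeasure \<nu> E \<le> emeasure \<nu> (A - C) + emeasure \<nu> (space \<nu> - A - C')"
      unfolding E_def using A C C' by (intro emeasure_subadditive) auto
    also have "\<dots> < ennreal (\<epsilon> / 2) + ennreal (\<epsilon> / 2)"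
      using C C' by (intro add_strict_mono)
    also have "\<dots> = ennreal \<epsilon>"
      using \<open>0 < \<epsilon>\<close> by (simp flip: ennreal_plus)
    finally show "emeasure \<nu> E < ennreal \<epsilon>" .
    fix t assume "t \<in> space \<nu> - E"
    then consider "t \<in> C" "t \<in> A" | "t \<in> C'" "t \<notin> A"
      by (auto simp: E_def)
    then show "\<lfloor>t / \<eta>\<rfloor> \<in> P \<longleftrightarrow> t \<in> A"
    proof cases
      case 1
      then show ?thesis by (auto simp: P_def)
    next
      case 2
      have "\<lfloor>t / \<eta>\<rfloor> \<noteq> \<lfloor>c / \<eta>\<rfloor>" if "c \<in> C" for c
      proof
        assume "\<lfloor>t / \<eta>\<rfloor> = \<lfloor>c / \<eta>\<rfloor>"
        then have "\<bar>c / \<eta> - t / \<eta>\<bar> < 1"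
          by linarith
        then have "\<bar>c - t\<bar> < \<eta>"
          using \<eta>(1) by (simp flip: diff_divide_distrib)
        then show False
          using \<eta>(2)[OF that 2(1)] by (simp add: dist_real_def)
      qed
      then show ?thesis
        using 2 by (auto simp: P_def)
    qed
  qed
qed

text \<open>The pointwise minimum over \<open>Y 0, \<dots>, Y n\<close> is attained by switching among these functions on
  measurable sets, and grid switching imitates this outside a set of small measure. That every value
  of \<open>y\<close> is a value of some \<open>Y k\<close> provides the domination needed on the exceptional set.\<close>
lemma grid_switching_approximates_minimum:
  fixes \<nu> :: "real measure" and h :: "real \<Rightarrow> 'a \<Rightarrow> ereal" and Y :: "nat \<Rightarrow> real \<Rightarrow> 'a"
  assumes inner: "\<And>A \<epsilon>. A \<in> sets \<nu> \<Longrightarrow> 0 < (\<epsilon> :: real) \<Longrightarrow>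
      \<exists>C\<in>sets \<nu>. compact C \<and> C \<subseteq> A \<and> emeasure \<nu> (A - C) < ennreal \<epsilon>"
    and borel: "sets (restrict_space borel (space \<nu>)) \<subseteq> sets \<nu>"
    and switch: "\<And>y z \<eta> P. y \<in> F \<Longrightarrow> z \<in> F \<Longrightarrow> 0 < \<eta> \<Longrightarrow>
      (\<lambda>t. if \<lfloor>t / \<eta>\<rfloor> \<in> P then y t else z t) \<in> F"
    and Y: "\<And>n. Y n \<in> F"
    and meas[measurable]: "\<And>n. (\<lambda>t. h t (Y n t)) \<in> borel_measurable \<nu>"
    and "0 < (\<epsilon> :: real)"
  shows "\<exists>y\<in>F. (\<lambda>t. h t (y t)) \<in> borel_measurable \<nu> \<and> (\<forall>t. \<exists>k\<le>n. y t = Y k t) \<and>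
    emeasure \<nu> {t \<in> space \<nu>. h t (y t) \<noteq> (INF k\<in>{..n}. h t (Y k t))} < ennreal \<epsilon>"
  using \<open>0 < \<epsilon>\<close>
proof (induction n arbitrary: \<epsilon>)
  case 0
  then show ?case
    using Y by (intro bexI[of _ "Y 0"]) auto
next
  case (Suc n)
  let ?g = "\<lambda>n t. INF k\<in>{..n}. h t (Y k t)"
  obtain y where y: "y \<in> F" "(\<lambda>t. h t (y t)) \<in> borel_measurable \<nu>" "\<And>t. \<exists>k\<le>n. y t = Y k t"
      "emeasure \<nu> {t \<in> space \<nu>. h t (y t) \<noteq> ?g n t} < ennreal (\<epsilon> / 2)"
    using Suc.IH[of "\<epsilon> / 2"] Suc.prems by auto
  note [measurable] = y(2)
  define A where "A = {t \<in> space \<nu>. ?g n t \<le> h t (Y (Suc n) t)}"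
  have A: "A \<in> sets \<nu>"
    unfolding A_def by measurable
  obtain \<eta> P E where E: "\<eta> > 0" "E \<in> sets \<nu>" "emeasure \<nu> E < ennreal (\<epsilon> / 2)"
      and P: "\<And>t. t \<in> space \<nu> - E \<Longrightarrow> \<lfloor>t / \<eta>\<rfloor> \<in> P \<longleftrightarrow> t \<in> A"
    by (rule measurable_set_grid_approximation[OF inner A, of "\<epsilon> / 2"]) (use Suc.prems in auto)
  note [measurable] = E(2)
  define x where "x = (\<lambda>t. if \<lfloor>t / \<eta>\<rfloor> \<in> P then y t else Y (Suc n) t)"
  have "{t. \<lfloor>t / \<eta>\<rfloor> \<in> P} \<in> sets (borel :: real measure)"
    by measurable
  then have "space \<nu> \<inter> {t. \<lfloor>t / \<eta>\<rfloor> \<in> P} \<in> sets (restrict_space borel (space \<nu>))"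
    unfolding sets_restrict_space by (rule imageI)
  then have "space \<nu> \<inter> {t. \<lfloor>t / \<eta>\<rfloor> \<in> P} \<in> sets \<nu>"
    by (rule subsetD[OF borel])
  then have [measurable]: "{t \<in> space \<nu>. \<lfloor>t / \<eta>\<rfloor> \<in> P} \<in> sets \<nu>"
    by (simp add: Int_def)
  have h_x: "h t (x t) = (if \<lfloor>t / \<eta>\<rfloor> \<in> P then h t (y t) else h t (Y (Suc n) t))" for t
    by (simp add: x_def)
  have x_meas[measurable]: "(\<lambda>t. h t (x t)) \<in> borel_measurable \<nu>"
    unfolding h_x by measurable
  have "{t \<in> space \<nu>. h t (x t) \<noteq> ?g (Suc n) t} \<subseteq> {t \<in> space \<nu>. h t (y t) \<noteq> ?g n t} \<union> E"
  proof
    fix t assume t: "t \<in> {t \<in> space \<nu>. h t (x t) \<noteq> ?g (Suc n) t}"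
    have g: "?g (Suc n) t = min (h t (Y (Suc n) t)) (?g n t)"
      by (simp add: atMost_Suc inf_min)
    show "t \<in> {t \<in> space \<nu>. h t (y t) \<noteq> ?g n t} \<union> E"
      using t P[of t] by (cases "t \<in> E") (auto simp: g h_x A_def min_def not_le split: if_splits)
  qed
  then have "emeasure \<nu> {t \<in> space \<nu>. h t (x t) \<noteq> ?g (Suc n) t} \<le>
      emeasure \<nu> ({t \<in> space \<nu>. h t (y t) \<noteq> ?g n t} \<union> E)"
    by (intro emeasure_mono) auto
  also have "\<dots> \<le> emeasure \<nu> {t \<in> space \<nu>. h t (y t) \<noteq> ?g n t} + emeasure \<nu> E"
    by (intro emeasure_subadditive) auto
  also have "\<dots> < ennreal (\<epsilon> / 2) + ennreal (\<epsilon> / 2)"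
    using y E by (intro add_strict_mono)
  also have "\<dots> = ennreal \<epsilon>"
    using Suc.prems by (simp flip: ennreal_plus)
  finally have less: "emeasure \<nu> {t \<in> space \<nu>. h t (x t) \<noteq> ?g (Suc n) t} < ennreal \<epsilon>" .
  have "x \<in> F"
    unfolding x_def using switch y(1) Y E(1) by blast
  moreover have "\<exists>k\<le>Suc n. x t = Y k t" for t
    using y(3)[of t] by (auto simp: x_def intro: le_SucI)
  ultimately show ?case
    using less x_meas by (intro bexI[of _ x]) auto
qed

section \<open>Extended real integrals\<close>

text \<open>The infimum is below \<open>c\<close> exactly when the epigraph meets the open set
  \<open>UNIV \<times> {r. ereal r < c}\<close>, so no measurable selection has to be made.\<close>
lemma borel_measurable_INF_normal_integrand:
  fixes h :: "'t \<Rightarrow> 'a::topological_space \<Rightarrow> ereal"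
  assumes "normal_integrand M h"
  shows "(\<lambda>t. INF y. h t y) \<in> borel_measurable M"
proof (rule borel_measurableI_less)
  fix c :: ereal
  let ?U = "UNIV \<times> {r. ereal r < c} :: ('a \<times> real) set"
  have "open {r. ereal r < c}"
    using open_vimage[of "{..<c}" ereal] by (simp add: vimage_def continuous_on_ereal)
  then have "open ?U"
    by (intro open_Times) auto
  then have "{t \<in> space M. epi (h t) \<inter> ?U \<noteq> {}} \<in> sets M"
    using assms by (auto simp: normal_integrand_def measurable_set_valued_def)
  moreover have "epi (h t) \<inter> ?U \<noteq> {} \<longleftrightarrow> (INF y. h t y) < c" for t
  proof
    assume "epi (h t) \<inter> ?U \<noteq> {}"
    then obtain x r where "h t x \<le> ereal r" "ereal r < c"
      by (auto simp: epi_def)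
    then show "(INF y. h t y) < c"
      by (auto simp: INF_less_iff intro: le_less_trans)
  next
    assume "(INF y. h t y) < c"
    then obtain x r where "h t x < ereal r" "ereal r < c"
      using ereal_dense2 by (metis INF_less_iff)
    then have "(x, r) \<in> epi (h t) \<inter> ?U"
      by (auto simp: epi_def)
    then show "epi (h t) \<inter> ?U \<noteq> {}"
      by blast
  qed
  ultimately show "{t \<in> space M. (INF y. h t y) < c} \<in> sets M"
    by simp
qed

lemma ereal_integral_mono:
  assumes "f \<in> borel_measurable M" and le: "\<And>t. t \<in> space M \<Longrightarrow> f t \<le> g t"
  shows "ereal_integral M f \<le> ereal_integral M g"
proof (cases "g \<in> borel_measurable M \<and> (\<integral>\<^sup>+t. e2ennreal (g t) \<partial>M) < \<infinity>")
  case True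
  have p: "(\<integral>\<^sup>+t. e2ennreal (f t) \<partial>M) \<le> (\<integral>\<^sup>+t. e2ennreal (g t) \<partial>M)"
    by (intro nn_integral_mono e2ennreal_mono le)
  have q: "(\<integral>\<^sup>+t. e2ennreal (- g t) \<partial>M) \<le> (\<integral>\<^sup>+t. e2ennreal (- f t) \<partial>M)"
    using le by (intro nn_integral_mono e2ennreal_mono) auto
  have "(\<integral>\<^sup>+t. e2ennreal (f t) \<partial>M) < \<infinity>"
    using p True by (auto intro: le_less_trans)
  then show ?thesis
    using True p q assms(1) by (auto simp: ereal_integral_def less_eq_ennreal.rep_eq intro!: ereal_minus_mono)
next
  case False
  then have "ereal_integral M g = \<infinity>"
    unfolding ereal_integral_def by (rule if_not_P)
  then show ?thesis
    by simp
qed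

lemma ereal_integral_cong_AE:
  assumes "f \<in> borel_measurable M" "g \<in> borel_measurable M" and eq: "AE t in M. f t = g t"
  shows "ereal_integral M f = ereal_integral M g"
proof -
  have "(\<integral>\<^sup>+t. e2ennreal (f t) \<partial>M) = (\<integral>\<^sup>+t. e2ennreal (g t) \<partial>M)"
    "(\<integral>\<^sup>+t. e2ennreal (- f t) \<partial>M) = (\<integral>\<^sup>+t. e2ennreal (- g t) \<partial>M)"
    using eq by (auto intro!: nn_integral_cong_AE)
  then show ?thesis
    using assms by (simp add: ereal_integral_def)
qed

lemma dom_integral_functionalD:
  assumes "y \<in> dom_integral_functional M h"
  shows "(\<lambda>t. h t (y t)) \<in> borel_measurable M" "(\<integral>\<^sup>+t. e2ennreal (h t (y t)) \<partial>M) < \<infinity>"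
proof -
  have "ereal_integral M (\<lambda>t. h t (y t)) \<noteq> \<infinity>"
    using assms by (simp add: dom_integral_functional_def integral_functional_def)
  then show "(\<lambda>t. h t (y t)) \<in> borel_measurable M" "(\<integral>\<^sup>+t. e2ennreal (h t (y t)) \<partial>M) < \<infinity>"
    by (auto simp: ereal_integral_def split: if_splits)
qed

lemma dom_integral_functional_AE_effective_domain:
  assumes "y \<in> dom_integral_functional M h"
  shows "AE t in M. y t \<in> effective_domain (h t)"
proof -
  note [measurable] = dom_integral_functionalD(1)[OF assms]
  have "AE t in M. e2ennreal (h t (y t)) \<noteq> \<infinity>"
    using dom_integral_functionalD(2)[OF assms] by (intro nn_integral_PInf_AE) auto
  then show ?thesis
    by eventually_elim (auto simp: effective_domain_def less_top)
qed

section \<open>The infimum over switching-closed families\<close>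

text \<open>Here \<open>p\<close>, \<open>q\<close> and \<open>a\<close>, \<open>b\<close> are the integrals of positive and negative parts; only \<open>q\<close> may be
  infinite, and then the left side is \<open>-\<infinity>\<close>.\<close>
lemma enn2ereal_diff_le_diff_plus:
  fixes p q a b :: ennreal and c \<delta> :: real
  assumes "p \<le> a + ennreal \<delta>" "b \<le> q + ennreal (c * \<delta>)" "a < \<infinity>" "b < \<infinity>" "0 \<le> c" "0 \<le> \<delta>"
  shows "enn2ereal p - enn2ereal q \<le> enn2ereal a - enn2ereal b + ereal ((1 + c) * \<delta>)"
proof (cases "q = \<infinity>")
  case True
  have "p < \<infinity>"
    using assms by (auto simp: ennreal_add_less_top intro: le_less_trans)
  then show ?thesis
    using True by (cases p) (auto simp: enn2ereal_ennreal)
next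
  case False
  have "p < \<infinity>"
    using assms by (auto simp: ennreal_add_less_top intro: le_less_trans)
  then obtain p' q' a' b' where r: "p = ennreal p'" "q = ennreal q'" "a = ennreal a'" "b = ennreal b'"
      "0 \<le> p'" "0 \<le> q'" "0 \<le> a'" "0 \<le> b'"
    using False assms by (metis ennreal_cases infinity_ennreal_def less_irrefl)
  have "p' \<le> a' + \<delta>" "b' \<le> q' + c * \<delta>"
    using assms r by (simp_all flip: ennreal_plus)
  then show ?thesis
    using r by (simp add: enn2ereal_ennreal algebra_simps)
qed

text \<open>An element of \<open>F\<close> that attains the minimum outside a set small for the weight
  \<open>1 + (\<Sum>k\<le>n. e2ennreal (h t (Y k t)))\<close> has almost the right integral: the positive part
  is dominated by the weight. The negative part of the minimum may fail to be integrable, so the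
  exceptional set could destroy an infinite integral; cutting that part off at \<open>n\<close> bounds the loss,
  and the cut disappears as \<open>n\<close> grows.\<close>
lemma INF_integral_functional_le_integral_finite_minimum:
  fixes \<mu> :: "real measure" and h :: "real \<Rightarrow> 'a \<Rightarrow> ereal" and Y :: "nat \<Rightarrow> real \<Rightarrow> 'a"
  assumes radon: "radon_measure_on {0..T} \<mu>"
    and switch: "\<And>y z \<eta> P. y \<in> F \<Longrightarrow> z \<in> F \<Longrightarrow> 0 < \<eta> \<Longrightarrow>
      (\<lambda>t. if \<lfloor>t / \<eta>\<rfloor> \<in> P then y t else z t) \<in> F"
    and Y: "\<And>n. Y n \<in> F"
    and meas[measurable]: "\<And>n. (\<lambda>t. h t (Y n t)) \<in> borel_measurable \<mu>"
    and fin: "\<And>n. (\<integral>\<^sup>+t. e2ennreal (h t (Y n t)) \<partial>\<mu>) < \<infinity>"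
  shows "(INF y\<in>F. integral_functional \<mu> h y) \<le>
    enn2ereal (\<integral>\<^sup>+t. e2ennreal (INF k\<in>{..n}. h t (Y k t)) \<partial>\<mu>) -
    enn2ereal (\<integral>\<^sup>+t. min (e2ennreal (- (INF k\<in>{..n}. h t (Y k t)))) (of_nat n) \<partial>\<mu>)"
    (is "?L \<le> enn2ereal ?a - enn2ereal ?b")
proof (rule ereal_le_epsilon2)
  fix e :: real assume "0 < e"
  let ?g = "\<lambda>t. INF k\<in>{..n}. h t (Y k t)"
  have sp: "space \<mu> = {0..T}"
    using radon by (simp add: radon_measure_on_def)
  have total: "emeasure \<mu> (space \<mu>) < \<infinity>"
    using radon by (auto simp: radon_measure_on_def)
  define \<delta> where "\<delta> = e / (1 + real n)"
  have \<delta>: "0 < \<delta>" "(1 + real n) * \<delta> = e"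
    using \<open>0 < e\<close> by (auto simp: \<delta>_def)
  \<comment> \<open>The summand \<open>1\<close> makes the weighted measure control \<open>\<mu>\<close> itself, as the truncated negative part needs.\<close>
  define w where "w = (\<lambda>t. 1 + (\<Sum>k\<le>n. e2ennreal (h t (Y k t))))"
  have w[measurable]: "w \<in> borel_measurable \<mu>"
    unfolding w_def by measurable
  have w_fin: "(\<integral>\<^sup>+t. w t \<partial>\<mu>) < \<infinity>"
    using fin total by (simp add: w_def nn_integral_add nn_integral_sum ennreal_add_less_top)
  have w_ge: "1 \<le> w t" for t
    by (simp add: w_def)
  have w_dom: "e2ennreal (h t (Y k t)) \<le> w t" if "k \<le> n" for k t
    using that member_le_sum[of k "{..n}" "\<lambda>k. e2ennreal (h t (Y k t))"]
    by (auto simp: w_def intro: add_increasing)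
  let ?\<nu> = "density \<mu> w"
  have "\<exists>y\<in>F. (\<lambda>t. h t (y t)) \<in> borel_measurable ?\<nu> \<and> (\<forall>t. \<exists>k\<le>n. y t = Y k t) \<and>
      emeasure ?\<nu> {t \<in> space ?\<nu>. h t (y t) \<noteq> ?g t} < ennreal \<delta>"
  proof (rule grid_switching_approximates_minimum)
    show "\<exists>C\<in>sets ?\<nu>. compact C \<and> C \<subseteq> A \<and> emeasure ?\<nu> (A - C) < ennreal \<epsilon>"
      if "A \<in> sets ?\<nu>" "0 < \<epsilon>" for A and \<epsilon> :: real
      using radon_density_inner_regular[OF radon w w_fin] that by simp
    show "sets (restrict_space borel (space ?\<nu>)) \<subseteq> sets ?\<nu>"
      using radon sp by (auto simp: radon_measure_on_def)
    show "(\<lambda>t. if \<lfloor>t / \<eta>\<rfloor> \<in> P then y t else z t) \<in> F" if "y \<in> F" "z \<in> F" "0 < \<eta>" for y z \<eta> P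
      using switch that by blast
  qed (use Y \<delta> in auto)
  then obtain y where y: "y \<in> F" and [measurable]: "(\<lambda>t. h t (y t)) \<in> borel_measurable \<mu>"
      and sel: "\<And>t. \<exists>k\<le>n. y t = Y k t"
      and small: "emeasure ?\<nu> {t \<in> space \<mu>. h t (y t) \<noteq> ?g t} < ennreal \<delta>"
    by auto
  define B where "B = {t \<in> space \<mu>. h t (y t) \<noteq> ?g t}"
  have [measurable]: "B \<in> sets \<mu>"
    unfolding B_def by measurable
  have int_B: "(\<integral>\<^sup>+t. w t * indicator B t \<partial>\<mu>) \<le> ennreal \<delta>"
    using small by (simp add: emeasure_density B_def[symmetric])
  have "(\<integral>\<^sup>+t. e2ennreal (h t (y t)) \<partial>\<mu>) \<le> (\<integral>\<^sup>+t. e2ennreal (?g t) + w t * indicator B t \<partial>\<mu>)"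
  proof (rule nn_integral_mono)
    fix t assume t: "t \<in> space \<mu>"
    obtain k where "k \<le> n" "y t = Y k t"
      using sel by blast
    then show "e2ennreal (h t (y t)) \<le> e2ennreal (?g t) + w t * indicator B t"
      using t w_dom[of k t] by (cases "t \<in> B") (auto simp: B_def intro: add_increasing)
  qed
  also have "\<dots> = ?a + (\<integral>\<^sup>+t. w t * indicator B t \<partial>\<mu>)"
    by (intro nn_integral_add) auto
  also have "\<dots> \<le> ?a + ennreal \<delta>"
    using int_B by (intro add_left_mono)
  finally have p: "(\<integral>\<^sup>+t. e2ennreal (h t (y t)) \<partial>\<mu>) \<le> ?a + ennreal \<delta>" .
  have "?b \<le> (\<integral>\<^sup>+t. e2ennreal (- h t (y t)) + of_nat n * (w t * indicator B t) \<partial>\<mu>)"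
  proof (rule nn_integral_mono)
    fix t assume t: "t \<in> space \<mu>"
    show "min (e2ennreal (- ?g t)) (of_nat n) \<le>
        e2ennreal (- h t (y t)) + of_nat n * (w t * indicator B t)"
    proof (cases "t \<in> B")
      case True
      have "of_nat n * 1 \<le> of_nat n * w t"
        by (intro mult_left_mono w_ge) auto
      then show ?thesis
        using True by (auto intro: min.coboundedI2 add_increasing)
    next
      case False
      then show ?thesis
        using t by (auto simp: B_def)
    qed
  qed
  also have "\<dots> = (\<integral>\<^sup>+t. e2ennreal (- h t (y t)) \<partial>\<mu>) + of_nat n * (\<integral>\<^sup>+t. w t * indicator B t \<partial>\<mu>)"
    by (simp add: nn_integral_add nn_integral_cmult)
  also have "\<dots> \<le> (\<integral>\<^sup>+t. e2ennreal (- h t (y t)) \<partial>\<mu>) + of_nat n * ennreal \<delta>"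
    using int_B by (intro add_left_mono mult_left_mono) auto
  also have "of_nat n * ennreal \<delta> = ennreal (real n * \<delta>)"
    using \<delta>(1) by (simp add: ennreal_mult ennreal_of_nat_eq_real_of_nat)
  finally have q: "?b \<le> (\<integral>\<^sup>+t. e2ennreal (- h t (y t)) \<partial>\<mu>) + ennreal (real n * \<delta>)" .
  have "?a \<le> (\<integral>\<^sup>+t. e2ennreal (h t (Y 0 t)) \<partial>\<mu>)"
    by (intro nn_integral_mono e2ennreal_mono INF_lower) auto
  then have a: "?a < \<infinity>"
    using fin[of 0] by (rule le_less_trans)
  have "?b \<le> (\<integral>\<^sup>+t. of_nat n \<partial>\<mu>)"
    by (intro nn_integral_mono) auto
  also have "\<dots> < \<infinity>"
    using total by (simp add: ennreal_mult_less_top of_nat_less_top)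
  finally have b: "?b < \<infinity>" .
  have "?a + ennreal \<delta> < \<infinity>"
    using a by (simp add: ennreal_add_less_top)
  then have "(\<integral>\<^sup>+t. e2ennreal (h t (y t)) \<partial>\<mu>) < \<infinity>"
    using p by (rule le_less_trans[rotated])
  then have "integral_functional \<mu> h y =
      enn2ereal (\<integral>\<^sup>+t. e2ennreal (h t (y t)) \<partial>\<mu>) - enn2ereal (\<integral>\<^sup>+t. e2ennreal (- h t (y t)) \<partial>\<mu>)"
    by (simp add: integral_functional_def ereal_integral_def)
  also have "\<dots> \<le> enn2ereal ?a - enn2ereal ?b + ereal ((1 + real n) * \<delta>)"
    using p q a b \<delta>(1) by (intro enn2ereal_diff_le_diff_plus) auto
  finally show "?L \<le> enn2ereal ?a - enn2ereal ?b + ereal e"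
    unfolding \<delta>(2) using INF_lower[OF y] by (rule order_trans[rotated])
qed

text \<open>The limit of the previous bound: the positive parts of the finite minima decrease under an
  integrable function, the truncated negative parts increase.\<close>
lemma INF_integral_functional_le_integral_INF:
  fixes \<mu> :: "real measure" and h :: "real \<Rightarrow> 'a \<Rightarrow> ereal" and Y :: "nat \<Rightarrow> real \<Rightarrow> 'a"
  assumes radon: "radon_measure_on {0..T} \<mu>"
    and switch: "\<And>y z \<eta> P. y \<in> F \<Longrightarrow> z \<in> F \<Longrightarrow> 0 < \<eta> \<Longrightarrow>
      (\<lambda>t. if \<lfloor>t / \<eta>\<rfloor> \<in> P then y t else z t) \<in> F"
    and Y: "\<And>n. Y n \<in> F"
    and meas[measurable]: "\<And>n. (\<lambda>t. h t (Y n t)) \<in> borel_measurable \<mu>"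
    and fin: "\<And>n. (\<integral>\<^sup>+t. e2ennreal (h t (Y n t)) \<partial>\<mu>) < \<infinity>"
  shows "(INF y\<in>F. integral_functional \<mu> h y) \<le> ereal_integral \<mu> (\<lambda>t. INF n. h t (Y n t))"
proof -
  define g where "g = (\<lambda>n t. INF k\<in>{..n}. h t (Y k t))"
  define m where "m = (\<lambda>t. INF n. h t (Y n t))"
  have [measurable]: "g n \<in> borel_measurable \<mu>" "m \<in> borel_measurable \<mu>" for n
    unfolding g_def m_def by measurable
  have dec: "g n t \<le> g k t" if "k \<le> n" for k n t
    unfolding g_def using that by (intro INF_superset_mono) auto
  have g_m: "(\<lambda>n. g n t) \<longlonglongrightarrow> m t" for t
  proof -
    have "(INF n. g n t) = m t"
    proof (rule antisym)
      show "(INF n. g n t) \<le> m t"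
        unfolding m_def g_def by (intro INF_mono) (auto intro: INF_lower)
      show "m t \<le> (INF n. g n t)"
        unfolding m_def g_def by (intro INF_greatest INF_superset_mono) auto
    qed
    then show ?thesis
      using LIMSEQ_INF[of "\<lambda>n. g n t"] dec by (simp add: decseq_def)
  qed
  have g0: "(\<integral>\<^sup>+t. e2ennreal (g 0 t) \<partial>\<mu>) < \<infinity>"
    using fin[of 0] by (simp add: g_def)
  have pos: "(\<lambda>n. \<integral>\<^sup>+t. e2ennreal (g n t) \<partial>\<mu>) \<longlonglongrightarrow> (\<integral>\<^sup>+t. e2ennreal (m t) \<partial>\<mu>)"
    by (rule nn_integral_dominated_convergence[where w = "\<lambda>t. e2ennreal (g 0 t)"])
      (use g0 in \<open>auto intro!: AE_I2 e2ennreal_mono dec tendsto_e2ennrealI g_m\<close>)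
  have neg: "(\<lambda>n. \<integral>\<^sup>+t. min (e2ennreal (- g n t)) (of_nat n) \<partial>\<mu>) \<longlonglongrightarrow> (\<integral>\<^sup>+t. e2ennreal (- m t) \<partial>\<mu>)"
  proof (rule nn_integral_LIMSEQ)
    show "incseq (\<lambda>n t. min (e2ennreal (- g n t)) (of_nat n))"
      unfolding incseq_def le_fun_def
      by (intro allI impI min.mono e2ennreal_mono) (use dec in auto)
    fix t
    have "(\<lambda>n. min (e2ennreal (- g n t)) (of_nat n)) \<longlonglongrightarrow> min (e2ennreal (- m t)) top"
      by (intro tendsto_min tendsto_e2ennrealI tendsto_uminus_ereal g_m of_nat_tendsto_top_ennreal)
    then show "(\<lambda>n. min (e2ennreal (- g n t)) (of_nat n)) \<longlonglongrightarrow> e2ennreal (- m t)"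
      by (simp add: min_absorb1)
  qed measurable
  have "(\<integral>\<^sup>+t. e2ennreal (m t) \<partial>\<mu>) \<le> (\<integral>\<^sup>+t. e2ennreal (h t (Y 0 t)) \<partial>\<mu>)"
    unfolding m_def by (intro nn_integral_mono e2ennreal_mono INF_lower) auto
  then have m_fin: "(\<integral>\<^sup>+t. e2ennreal (m t) \<partial>\<mu>) < \<infinity>"
    using fin[of 0] by (rule le_less_trans)
  have "(INF y\<in>F. integral_functional \<mu> h y) \<le>
      enn2ereal (\<integral>\<^sup>+t. e2ennreal (m t) \<partial>\<mu>) - enn2ereal (\<integral>\<^sup>+t. e2ennreal (- m t) \<partial>\<mu>)"
  proof (rule LIMSEQ_le_const)
    have "enn2ereal (\<integral>\<^sup>+t. e2ennreal (m t) \<partial>\<mu>) \<noteq> \<infinity>"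
      using m_fin by (cases "\<integral>\<^sup>+t. e2ennreal (m t) \<partial>\<mu>") (auto simp: enn2ereal_ennreal)
    then show "(\<lambda>n. enn2ereal (\<integral>\<^sup>+t. e2ennreal (g n t) \<partial>\<mu>) -
          enn2ereal (\<integral>\<^sup>+t. min (e2ennreal (- g n t)) (of_nat n) \<partial>\<mu>))
        \<longlonglongrightarrow> enn2ereal (\<integral>\<^sup>+t. e2ennreal (m t) \<partial>\<mu>) - enn2ereal (\<integral>\<^sup>+t. e2ennreal (- m t) \<partial>\<mu>)"
      by (intro tendsto_diff_ereal_general tendsto_enn2erealI pos neg) auto
    show "\<exists>N. \<forall>n\<ge>N. (INF y\<in>F. integral_functional \<mu> h y) \<le>
        enn2ereal (\<integral>\<^sup>+t. e2ennreal (g n t) \<partial>\<mu>) -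
        enn2ereal (\<integral>\<^sup>+t. min (e2ennreal (- g n t)) (of_nat n) \<partial>\<mu>)"
      unfolding g_def
      by (intro exI allI impI
          INF_integral_functional_le_integral_finite_minimum[where h = h and Y = Y, OF radon switch Y meas fin])
  qed
  also have "\<dots> = ereal_integral \<mu> m"
    using m_fin by (simp add: ereal_integral_def)
  finally show ?thesis
    unfolding m_def .
qed

section \<open>Interchange of infimum and integral\<close>

theorem theorem15:
  fixes T :: real
    and \<mu> :: "real measure"
    and h :: "real \<Rightarrow> 'a::euclidean_space \<Rightarrow> ereal"
    and S :: "real \<Rightarrow> 'a set"
  assumes "T > 0"
    and "radon_measure_on {0..T} \<mu>"
    and "convex_normal_integrand \<mu> h"
    and "\<And>t. t \<in> {0..T} \<Longrightarrow> S t = closure (effective_domain (h t))"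
    and "\<And>t. t \<in> {0..T} \<Longrightarrow> S t = closure {y t | y. y \<in> cadlag_selections T S}"
    and "\<And>y. y \<in> cadlag_selections T S \<Longrightarrow>
           \<exists>Y :: nat \<Rightarrow> real \<Rightarrow> 'a.
             (\<forall>\<nu>. Y \<nu> \<in> dom_integral_functional \<mu> h \<inter> cadlag_selections T S) \<and>
             (\<forall>t\<in>{0..T}. (\<lambda>\<nu>. Y \<nu> t) \<longlonglongrightarrow> y t)"
    and "(INF y\<in>cadlag_selections T S. integral_functional \<mu> h y) < \<infinity>"
  shows "(INF y\<in>cadlag_selections T S. integral_functional \<mu> h y) =
         ereal_integral \<mu> (\<lambda>t. INF y. h t y)"
proof (rule antisym)
  let ?D = "cadlag_selections T S"
  have sp: "space \<mu> = {0..T}"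
    using assms(2) by (simp add: radon_measure_on_def)
  have inf_meas: "(\<lambda>t. INF y. h t y) \<in> borel_measurable \<mu>"
    using assms(3) by (intro borel_measurable_INF_normal_integrand) (simp add: convex_normal_integrand_def)
  show "ereal_integral \<mu> (\<lambda>t. INF y. h t y) \<le> (INF y\<in>?D. integral_functional \<mu> h y)"
    unfolding integral_functional_def
    by (intro INF_greatest ereal_integral_mono inf_meas INF_lower) auto
  obtain J where J: "J \<subseteq> ?D" "countable J"
      "\<And>t y. t \<in> {0..T} \<Longrightarrow> y \<in> ?D \<Longrightarrow> y t \<in> closure {z t | z. z \<in> J}"
    by (rule cadlag_family_countable_dense[of ?D T]) (auto simp: cadlag_selections_def)
  obtain X where X: "\<And>y \<nu>. y \<in> ?D \<Longrightarrow> X y \<nu> \<in> dom_integral_functional \<mu> h \<inter> ?D"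
      "\<And>y t. y \<in> ?D \<Longrightarrow> t \<in> {0..T} \<Longrightarrow> (\<lambda>\<nu>. X y \<nu> t) \<longlonglongrightarrow> y t"
    using assms(6) by metis
  \<comment> \<open>The members of \<open>J\<close> need not lie in the domain of the functional; the terms of their approximating
    sequences do, and are still countably many and dense.\<close>
  define Z where "Z = (\<Union>y\<in>J. range (X y))"
  have "?D \<noteq> {}"
    using assms(7) by (auto simp: top_ereal_def)
  then have "J \<noteq> {}"
    using J(3)[of 0] \<open>T > 0\<close> by auto
  then have Z: "Z \<noteq> {}" "countable Z" "Z \<subseteq> dom_integral_functional \<mu> h \<inter> ?D"
    using J X(1) by (auto simp: Z_def)
  have dense: "S t \<subseteq> closure {z t | z. z \<in> Z}" if t: "t \<in> {0..T}" for t
  proof -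
    have "z t \<in> closure {z t | z. z \<in> Z}" if "z \<in> J" for z
    proof -
      have "X z \<nu> t \<in> {z t | z. z \<in> Z}" for \<nu>
        using that by (auto simp: Z_def)
      then show ?thesis
        using X(2)[of z t] subsetD[OF J(1) that] t unfolding closure_sequential
        by (intro exI[of _ "\<lambda>\<nu>. X z \<nu> t"]) blast
    qed
    then have "{z t | z. z \<in> J} \<subseteq> closure {z t | z. z \<in> Z}"
      by blast
    then have "closure {z t | z. z \<in> J} \<subseteq> closure {z t | z. z \<in> Z}"
      by (intro closure_minimal) auto
    then have "{y t | y. y \<in> ?D} \<subseteq> closure {z t | z. z \<in> Z}"
      using J(3)[OF t] by blast
    then show ?thesis
      unfolding assms(5)[OF t] by (intro closure_minimal) auto
  qed
  define Y where "Y = from_nat_into Z"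
  have range_Y: "range Y = Z"
    using Z by (simp add: Y_def)
  then have Y: "Y n \<in> dom_integral_functional \<mu> h" "Y n \<in> ?D" for n
    using Z(3) by blast+
  have "AE t in \<mu>. (INF n. h t (Y n t)) = (INF y. h t y)"
  proof -
    have "AE t in \<mu>. \<forall>n. Y n t \<in> effective_domain (h t)"
      unfolding AE_all_countable using Y(1) dom_integral_functional_AE_effective_domain by blast
    then show ?thesis
    proof (rule AE_mp, intro AE_I2 impI)
      fix t assume t: "t \<in> space \<mu>" and dom: "\<forall>n. Y n t \<in> effective_domain (h t)"
      have "range (\<lambda>n. Y n t) = {z t | z. z \<in> Z}"
        by (auto simp flip: range_Y)
      then have "effective_domain (h t) \<subseteq> closure (range (\<lambda>n. Y n t))"
        using dense[of t] assms(4)[of t] closure_subset t sp by fastforce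
      moreover have "convex (epi (h t))"
        using assms(3) t by (simp add: convex_normal_integrand_def)
      ultimately have "(INF x\<in>range (\<lambda>n. Y n t). h t x) = (INF y. h t y)"
        using dom by (intro INF_dense_subset_of_effective_domain) auto
      then show "(INF n. h t (Y n t)) = (INF y. h t y)"
        by (simp add: image_image)
    qed
  qed
  moreover have "(\<lambda>t. INF n. h t (Y n t)) \<in> borel_measurable \<mu>"
    using dom_integral_functionalD(1)[OF Y(1)] by measurable
  ultimately have "ereal_integral \<mu> (\<lambda>t. INF n. h t (Y n t)) = ereal_integral \<mu> (\<lambda>t. INF y. h t y)"
    using inf_meas by (intro ereal_integral_cong_AE)
  moreover have "(INF y\<in>?D. integral_functional \<mu> h y) \<le> ereal_integral \<mu> (\<lambda>t. INF n. h t (Y n t))"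
  proof (rule INF_integral_functional_le_integral_INF[OF assms(2)])
    show "(\<lambda>t. if \<lfloor>t / \<eta>\<rfloor> \<in> P then y t else z t) \<in> ?D" if "y \<in> ?D" "z \<in> ?D" "0 < \<eta>" for y z \<eta> P
      using that cadlag_on_grid_switch[of T y z \<eta> P] by (auto simp: cadlag_selections_def)
  qed (use Y dom_integral_functionalD in blast)+
  ultimately show "(INF y\<in>?D. integral_functional \<mu> h y) \<le> ereal_integral \<mu> (\<lambda>t. INF y. h t y)"
    by simp
qed

end
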